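(* Let $U$ be a totally unimodular matrix with no zero columns, and let $A=U^\dagger U$ (which is $g$-nonnegative). Then the rows of $X(A)$ can be permuted so that they are exactly the nonzero rows of $U^\sharp$; that is, up to a permutation of rows, $X(A)$ is the matrix obtained from $U^\sharp$ by deleting its zero rows.
   Context: An integer matrix is totally unimodular (TU) if every square submatrix has determinant in $\{-1,0,+1\}$. For a real matrix $M$, $M^\sharp$ is the matrix of absolute values of the entries of $M$, and $M^\dagger$ is the transpose. $[s]=\{1,\ldots,s\}$. Let $A=(a_{ij})$ be an $s\times s$ symmetric integer matrix with positive diagonal entries. A three-element subset $\{h,i,j\}\subseteq[s]$ is a negative triple if $a_{hi}a_{ij}a_{jh}<0$; $\Delta(A)$ is the set of negative triples. Define $f_A:2^{[s]}\to\mathbb{N}$ as follows: $f_A(\varnothing)=0$; $f_A(S)=0$ if $Y\subseteq S$ for some $Y\in\Delta(A)$; $f_A(\{i\})=a_{ii}$; and otherwise $f_A(S)=\min\{|a_{ij}|:\{i,j\}\subseteq S,\ i\neq j\}$. Define $$g_A(S)=\sum_{S\subseteq S'\subseteq[s]}(-1)^{|S'\setminus S|}f_A(S').$$ $A$ is $g$-nonnegative if $g_A(S)\ge0$ for all $\varnothing\ne S\subseteq[s]$. For a $g$-nonnegative $A$, let $k=-g_A(\varnothing)=\sum_{\varnothing\neq S\subseteq[s]}g_A(S)\ge 0$. Then $X(A)$ is the $k\times s$ $\{0,1\}$-matrix in which, for each $\varnothing\neq S\subseteq[s]$, exactly $g_A(S)$ rows are equal to the indicator row-vector of $S$; it is defined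 up to permutation of rows. *)

theory Defs
  imports "Jordan_Normal_Form.Determinant" "Jordan_Normal_Form.DL_Submatrix" "HOL-Combinatorics.Permutations"
begin

text \<open>
  Matrices are the dimension-carrying matrices of \<^theory>\<open>Jordan_Normal_Form.Matrix\<close>;
  rows and columns are numbered from 0, so the index set \<open>[s]\<close> becomes \<open>{..<s}\<close>.
\<close>

definition totally_unimodular :: "int mat \<Rightarrow> bool" where
  "totally_unimodular U \<longleftrightarrow>
     (\<forall>I J. I \<subseteq> {..<dim_row U} \<longrightarrow> J \<subseteq> {..<dim_col U} \<longrightarrow> card I = card J \<longrightarrow>
        det (submatrix U I J) \<in> {-1, 0, 1})"

definition no_zero_cols :: "'a::zero mat \<Rightarrow> bool" where
  "no_zero_cols U \<longleftrightarrow> (\<forall>j<dim_col U. col U j \<noteq> 0\<^sub>v (dim_row U))"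

definition abs_mat :: "'a::abs mat \<Rightarrow> 'a mat" where
  "abs_mat M = map_mat abs M"

definition delete_zero_rows :: "'a::zero mat \<Rightarrow> 'a mat" where
  "delete_zero_rows M =
     mat_of_rows (dim_col M) (filter (\<lambda>v. v \<noteq> 0\<^sub>v (dim_col M)) (rows M))"

definition permute_rows :: "(nat \<Rightarrow> nat) \<Rightarrow> 'a mat \<Rightarrow> 'a mat" where
  "permute_rows p M = mat (dim_row M) (dim_col M) (\<lambda>(i, j). M $$ (p i, j))"

definition symmetric_posdiag :: "int mat \<Rightarrow> bool" where
  "symmetric_posdiag A \<longleftrightarrow>
     square_mat A \<and> transpose_mat A = A \<and> (\<forall>i<dim_row A. A $$ (i, i) > 0)"

definition negative_triples :: "int mat \<Rightarrow> nat set set" where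
  "negative_triples A =
     {{h, i, j} | h i j. h < dim_row A \<and> i < dim_row A \<and> j < dim_row A
        \<and> h \<noteq> i \<and> i \<noteq> j \<and> h \<noteq> j
        \<and> A $$ (h, i) * A $$ (i, j) * A $$ (j, h) < 0}"

text \<open>
  \<open>f_fun\<close> and \<open>g_fun\<close> are only meaningful for \<open>S \<subseteq> {..<dim_row A}\<close>. Both are
  integer-valued so that the signed sum in \<open>g_fun\<close> does not truncate.
\<close>

definition f_fun :: "int mat \<Rightarrow> nat set \<Rightarrow> int" where
  "f_fun A S =
     (if S = {} then 0
      else if \<exists>Y\<in>negative_triples A. Y \<subseteq> S then 0
      else if card S = 1 then A $$ (the_elem S, the_elem S)
      else Min {\<bar>A $$ (i, j)\<bar> | i j. i \<in> S \<and> j \<in> S \<and> i \<noteq> j})"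

definition g_fun :: "int mat \<Rightarrow> nat set \<Rightarrow> int" where
  "g_fun A S =
     (\<Sum>S' \<in> {S'. S \<subseteq> S' \<and> S' \<subseteq> {..<dim_row A}}. (-1) ^ card (S' - S) * f_fun A S')"

definition g_nonnegative :: "int mat \<Rightarrow> bool" where
  "g_nonnegative A \<longleftrightarrow>
     symmetric_posdiag A \<and> (\<forall>S. S \<noteq> {} \<longrightarrow> S \<subseteq> {..<dim_row A} \<longrightarrow> g_fun A S \<ge> 0)"

definition indicator_vec :: "nat \<Rightarrow> nat set \<Rightarrow> int vec" where
  "indicator_vec s S = vec s (\<lambda>j. of_bool (j \<in> S))"

text \<open>
  Since \<open>X(A)\<close> is determined only up to a permutation of its rows, it is rendered as a
  predicate: \<open>is_X A X\<close> says that \<open>X\<close> is one of the matrices \<open>X(A)\<close>.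
\<close>

definition is_X :: "int mat \<Rightarrow> int mat \<Rightarrow> bool" where
  "is_X A X \<longleftrightarrow>
     int (dim_row X) = - g_fun A {} \<and> dim_col X = dim_row A
     \<and> elements_mat X \<subseteq> {0, 1}
     \<and> (\<forall>S. S \<noteq> {} \<longrightarrow> S \<subseteq> {..<dim_row A} \<longrightarrow>
          int (card {i. i < dim_row X \<and> row X i = indicator_vec (dim_row A) S}) = g_fun A S)"

text \<open>The predicate is inhabited for every \<open>g\<close>-nonnegative matrix.\<close>

lemma sum_g_fun: "(\<Sum>S\<in>Pow {..<dim_row A}. g_fun A S) = 0"
proof -
  let ?N = "{..<dim_row A}"
  have "(\<Sum>S\<in>Pow ?N. g_fun A S) =
      (\<Sum>S\<in>Pow ?N. \<Sum>T\<in>{T\<in>Pow ?N. S \<subseteq> T}. (-1) ^ card (T - S) * f_fun A T)"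
    unfolding g_fun_def by (intro sum.cong) auto
  also have "\<dots> = (\<Sum>T\<in>Pow ?N. \<Sum>S\<in>{S\<in>Pow ?N. S \<subseteq> T}. (-1) ^ card (T - S) * f_fun A T)"
    by (rule sum.swap_restrict) auto
  also have "\<dots> = (\<Sum>T\<in>Pow ?N. 0)"
  proof (intro sum.cong refl)
    fix T assume T: "T \<in> Pow ?N"
    then have fin: "finite T" using finite_subset by auto
    show "(\<Sum>S\<in>{S\<in>Pow ?N. S \<subseteq> T}. (-1) ^ card (T - S) * f_fun A T) = 0"
    proof (cases "T = {}")
      case True
      then show ?thesis by (simp add: f_fun_def)
    next
      case False
      have set_eq: "{S\<in>Pow ?N. S \<subseteq> T} = Pow T" using T by auto
      have "(\<Sum>S\<in>Pow T. (-1 :: int) ^ card (T - S)) = (\<Sum>S\<in>Pow T. (-1) ^ card S)"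
        by (rule sum.reindex_bij_witness[where i = "\<lambda>S. T - S" and j = "\<lambda>S. T - S"]) auto
      also have "\<dots> = 0"
      proof -
        have "card {S. S \<subseteq> T \<and> even (card S)} = card {S. S \<subseteq> T \<and> odd (card S)}"
          using card_subsupersets_even_odd[of T "{}"] fin False by auto
        then show ?thesis
          using fin by (intro sum_alternating_cancels) (auto simp: Pow_def)
      qed
      finally show ?thesis
        unfolding set_eq sum_distrib_right[symmetric] by simp
    qed
  qed
  finally show ?thesis by simp
qed

lemma is_X_exists:
  assumes "g_nonnegative A"
  shows "\<exists>X. is_X A X"
proof -
  define s where "s = dim_row A"
  let ?P = "Pow {..<s} - {{}}"
  let ?ind = "indicator_vec s"
  obtain L where L: "set L = ?P" "distinct L"
    using finite_distinct_list[of ?P] by auto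
  define xs where "xs = concat (map (\<lambda>S. replicate (nat (g_fun A S)) (?ind S)) L)"
  define X where "X = mat_of_rows s xs"
  have nn: "g_fun A S \<ge> 0" if "S \<in> ?P" for S
    using assms that by (auto simp: g_nonnegative_def s_def)
  have inj: "S = T" if "S \<in> ?P" "T \<in> ?P" "?ind S = ?ind T" for S T
  proof -
    have "j \<in> S \<longleftrightarrow> j \<in> T" if "j < s" for j
      using arg_cong[OF \<open>?ind S = ?ind T\<close>, of "\<lambda>v. v $ j"] that
      by (auto simp: indicator_vec_def split: if_splits)
    then show ?thesis using that by blast
  qed
  have len: "int (length xs) = (\<Sum>S\<in>?P. g_fun A S)"
  proof -
    have "length xs = (\<Sum>S\<in>?P. nat (g_fun A S))"
      using L by (simp add: xs_def length_concat comp_def sum_list_distinct_conv_sum_set)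
    then show ?thesis using nn by simp
  qed
  have sum0: "(\<Sum>S\<in>?P. g_fun A S) = - g_fun A {}"
    using sum_g_fun[of A] sum.remove[of "Pow {..<s}" "{}" "g_fun A"] by (simp add: s_def)
  have mem: "\<exists>S. x = ?ind S" if "x \<in> set xs" for x
    using that by (auto simp: xs_def)
  have row: "row X i = xs ! i" if "i < length xs" for i
    using mem[OF nth_mem[OF that]] that
    by (auto simp: X_def indicator_vec_def intro!: mat_of_rows_row)
  have cnt: "int (card {i. i < dim_row X \<and> row X i = ?ind S}) = g_fun A S" if S: "S \<in> ?P" for S
  proof -
    have "{i. i < dim_row X \<and> row X i = ?ind S} = {i. i < length xs \<and> xs ! i = ?ind S}"
      using row by (auto simp: X_def)
    then have "card {i. i < dim_row X \<and> row X i = ?ind S} = length (filter (\<lambda>v. v = ?ind S) xs)"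
      by (simp add: length_filter_conv_card)
    also have "\<dots> = (\<Sum>T\<in>?P. if ?ind T = ?ind S then nat (g_fun A T) else 0)"
      using L by (simp add: xs_def filter_concat length_concat comp_def
          sum_list_distinct_conv_sum_set filter_replicate if_distrib[of length] cong: if_cong)
    also have "\<dots> = (\<Sum>T\<in>?P. if T = S then nat (g_fun A T) else 0)"
      using inj S by (intro sum.cong) auto
    also have "\<dots> = nat (g_fun A S)" using S by (simp add: sum.delta)
    finally show ?thesis using nn[OF S] by simp
  qed
  have "elements_mat X \<subseteq> {0, 1}"
  proof
    fix a assume "a \<in> elements_mat X"
    then obtain i j where ij: "i < length xs" "j < s" "a = X $$ (i, j)"
      by (auto simp: X_def elements_mat_def)
    moreover obtain S where "xs ! i = ?ind S" using mem[OF nth_mem[OF ij(1)]] by auto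
    ultimately show "a \<in> {0, 1}" by (auto simp: X_def mat_of_rows_def indicator_vec_def)
  qed
  moreover have "int (dim_row X) = - g_fun A {}" using len sum0 by (simp add: X_def)
  ultimately have "is_X A X"
    using cnt unfolding is_X_def s_def by (auto simp: X_def s_def)
  then show ?thesis by blast
qed

end

theory Submission
  imports Defs
begin

text \<open>
  Write \<open>N(S)\<close> for the number of rows of \<open>U\<close> that are nonzero in every column of \<open>S\<close>. The
  theorem follows from the identity \<open>f\<^sub>A(S) = N(S)\<close> for all nonempty \<open>S\<close>: Moebius inversion
  over the subset lattice then turns \<open>g\<^sub>A(S)\<close> into the number of rows whose support is exactly \<open>S\<close>,
  so \<open>g\<^sub>A\<close> is nonnegative and counts precisely the rows of \<open>U\<^sup>\<sharp>\<close> equal to the indicator of \<open>S\<close>.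

  The identity only uses minors of order at most three. An order-two minor \<open>\<plusminus>2\<close> is excluded, so for
  fixed columns \<open>i \<noteq> j\<close> all nonzero products \<open>u\<^sub>r\<^sub>i u\<^sub>r\<^sub>j\<close> have the same sign. Hence there is no
  cancellation in \<open>a\<^sub>i\<^sub>j\<close>: its modulus is \<open>N({i, j})\<close>, and its sign can be read off from any row
  covering both columns (\<open>gram_entry_eq_card\<close>, \<open>abs_gram_entry\<close>).

  If one row covers \<open>h, i, j\<close>, the product \<open>a\<^sub>h\<^sub>i a\<^sub>i\<^sub>j a\<^sub>j\<^sub>h\<close> has the sign of the square
  \<open>(u\<^sub>r\<^sub>h u\<^sub>r\<^sub>i u\<^sub>r\<^sub>j)\<^sup>2\<close>, so no row covers a negative triple
  (\<open>covering_rows_negative_triple\<close>). If \<open>{h, i, j}\<close> is not a negative triple, there cannot be three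
  rows that restrict on these columns to the supports \<open>{h, i}\<close>, \<open>{i, j}\<close>, \<open>{j, h}\<close>: the minor they
  form would be \<open>\<plusminus>2\<close>. Therefore, with \<open>R\<^sub>i\<close> the set of rows covering \<open>i\<close>, one of the three pairwise
  intersections of \<open>R\<^sub>h, R\<^sub>i, R\<^sub>j\<close> lies in the third set (\<open>covering_rows_triple_nested\<close>).

  This triple property settles arbitrary \<open>S\<close> without negative triples. Take a pair \<open>i, j\<close> in \<open>S\<close>
  minimising \<open>|R\<^sub>i \<inter> R\<^sub>j|\<close>. If some \<open>R\<^sub>k\<close> did not contain \<open>R\<^sub>i \<inter> R\<^sub>j\<close>, then one of
  \<open>R\<^sub>j \<inter> R\<^sub>k\<close>, \<open>R\<^sub>k \<inter> R\<^sub>i\<close> would be a proper subset of \<open>R\<^sub>i \<inter> R\<^sub>j\<close>, contradicting minimality. So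
  \<open>N(S) = |R\<^sub>i \<inter> R\<^sub>j|\<close>, which is the minimum defining \<open>f\<^sub>A(S)\<close> (\<open>f_fun_gram_eq_card\<close>).
\<close>

section \<open>Small minors of totally unimodular matrices\<close>

text \<open>
  Submatrices list their rows and columns in increasing order. Listing them in another order
  permutes rows and columns, which changes the determinant by a sign only; so rows and columns
  can be chosen below in whatever order is convenient.
\<close>
lemma totally_unimodular_det_minor:
  assumes "totally_unimodular U"
    and rs: "distinct rs" "set rs \<subseteq> {..<dim_row U}" "length rs = k"
    and cs: "distinct cs" "set cs \<subseteq> {..<dim_col U}" "length cs = k"
  shows "det (mat k k (\<lambda>(a, b). U $$ (rs ! a, cs ! b))) \<in> {-1, 0, 1}"
proof -
  \<comment> \<open>The position that the entry \<open>xs ! a\<close> takes when the list is sorted; extended by the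
    identity so that it becomes a permutation in the sense of \<open>permutes\<close>.\<close>
  define rank :: "nat list \<Rightarrow> nat \<Rightarrow> nat"
    where "rank xs a = (if a < k then card {x \<in> set xs. x < xs ! a} else a)" for xs a
  have pick_rank: "pick (set xs) (rank xs a) = xs ! a" if "a < k" "length xs = k" for xs a
    using that by (simp add: rank_def pick_card_in_set)
  have rank_permutes: "rank xs permutes {0..<k}" if xs: "distinct xs" "length xs = k" for xs
  proof (rule bij_imp_permutes)
    have "inj_on (rank xs) {0..<k}"
    proof (rule inj_onI)
      fix a b assume "a \<in> {0..<k}" "b \<in> {0..<k}" "rank xs a = rank xs b"
      then have "xs ! a = xs ! b" using pick_rank[of a xs] pick_rank[of b xs] xs by simp
      then show "a = b" using xs \<open>a \<in> _\<close> \<open>b \<in> _\<close> by (simp add: nth_eq_iff_index_eq)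
    qed
    moreover have "rank xs ` {0..<k} \<subseteq> {0..<k}"
    proof (intro image_subsetI)
      fix a assume "a \<in> {0..<k}"
      then have "{x \<in> set xs. x < xs ! a} \<subset> set xs"
        using xs nth_mem[of a xs] by fastforce
      then have "card {x \<in> set xs. x < xs ! a} < card (set xs)"
        by (rule psubset_card_mono[OF finite_set])
      then show "rank xs a \<in> {0..<k}" using xs \<open>a \<in> _\<close> by (simp add: rank_def distinct_card)
    qed
    ultimately show "bij_betw (rank xs) {0..<k} {0..<k}"
      by (simp add: bij_betw_def endo_inj_surj)
  qed (auto simp: rank_def)
  define B where "B = submatrix U (set rs) (set cs)"
  have "{i. i < dim_row U \<and> i \<in> set rs} = set rs" "{j. j < dim_col U \<and> j \<in> set cs} = set cs"
    using rs cs by auto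
  then have B: "B = mat k k (\<lambda>(i, j). U $$ (pick (set rs) i, pick (set cs) j))"
    using rs cs by (simp add: B_def submatrix_def distinct_card)
  have det_B: "det B \<in> {-1, 0, 1}"
    using assms by (simp add: B_def totally_unimodular_def distinct_card)
  \<comment> \<open>Only row permutations are treated by \<open>det_permute_rows\<close>, so the columns are permuted
    after a transposition.\<close>
  define C where "C = mat k k (\<lambda>(i, j). B $$ (rank rs i, j))"
  have C: "C \<in> carrier_mat k k" and "B \<in> carrier_mat k k" by (simp_all add: C_def B)
  have det_C: "det C = signof (rank rs) * det B"
    unfolding C_def by (rule det_permute_rows) (use rs rank_permutes in \<open>simp_all add: B\<close>)
  have rank_less: "rank xs a < k" if "distinct xs" "length xs = k" "a < k" for xs a
    using permutes_in_image[OF rank_permutes[OF that(1,2)], of a] that by simp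
  have "mat k k (\<lambda>(i, j). (transpose_mat C) $$ (rank cs i, j))
      = transpose_mat (mat k k (\<lambda>(a, b). U $$ (rs ! a, cs ! b)))"
    (is "?L = ?R")
  proof (rule eq_matI)
    fix a b assume "a < dim_row ?R" "b < dim_col ?R"
    then have ab: "a < k" "b < k" by simp_all
    then have "rank cs a < k" "rank rs b < k" using rank_less rs cs by blast+
    then show "?L $$ (a, b) = ?R $$ (a, b)"
      using ab pick_rank[OF ab(1) cs(3)] pick_rank[OF ab(2) rs(3)] by (simp add: C_def B)
  qed simp_all
  moreover have "det (mat k k (\<lambda>(i, j). (transpose_mat C) $$ (rank cs i, j)))
      = signof (rank cs) * det C"
    using det_permute_rows[of "transpose_mat C" k "rank cs"] rank_permutes[of cs] cs C
    by (simp add: det_transpose[OF C])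
  ultimately have "det (mat k k (\<lambda>(a, b). U $$ (rs ! a, cs ! b)))
      = signof (rank cs) * signof (rank rs) * det B"
    using det_transpose[of "mat k k (\<lambda>(a, b). U $$ (rs ! a, cs ! b))" k] det_C by simp
  then show ?thesis using det_B by (auto simp: sign_def)
qed

lemma det_2_2:
  fixes A :: "'a::comm_ring_1 mat"
  assumes A: "A \<in> carrier_mat 2 2"
  shows "det A = A $$ (0, 0) * A $$ (1, 1) - A $$ (0, 1) * A $$ (1, 0)"
proof -
  have "det A = (\<Sum>j<2. A $$ (0, j) * cofactor A 0 j)"
    by (rule laplace_expansion_row[OF A]) simp
  then have "det A = A $$ (0, 0) * det (mat_delete A 0 0) - A $$ (0, 1) * det (mat_delete A 0 1)"
    by (simp add: cofactor_def numeral_2_eq_2)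
  moreover have "det (mat_delete A i j) = mat_delete A i j $$ (0, 0)" for i j
    by (rule det_single) (use A in \<open>auto simp: mat_delete_def\<close>)
  ultimately show ?thesis
    using A by (simp only:) (simp add: mat_delete_def)
qed

lemma det_3_3:
  fixes A :: "'a::comm_ring_1 mat"
  assumes A: "A \<in> carrier_mat 3 3"
  shows "det A =
      A $$ (0, 0) * (A $$ (1, 1) * A $$ (2, 2) - A $$ (1, 2) * A $$ (2, 1))
    - A $$ (0, 1) * (A $$ (1, 0) * A $$ (2, 2) - A $$ (1, 2) * A $$ (2, 0))
    + A $$ (0, 2) * (A $$ (1, 0) * A $$ (2, 1) - A $$ (1, 1) * A $$ (2, 0))"
proof -
  have "det A = (\<Sum>j<3. A $$ (0, j) * cofactor A 0 j)"
    by (rule laplace_expansion_row[OF A]) simp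
  then have "det A = A $$ (0, 0) * det (mat_delete A 0 0)
      - A $$ (0, 1) * det (mat_delete A 0 1) + A $$ (0, 2) * det (mat_delete A 0 2)"
    by (simp add: cofactor_def numeral_3_eq_3 numeral_2_eq_2)
  moreover have "det (mat_delete A i j) =
      mat_delete A i j $$ (0, 0) * mat_delete A i j $$ (1, 1)
    - mat_delete A i j $$ (0, 1) * mat_delete A i j $$ (1, 0)" for i j
    by (rule det_2_2) (use A in \<open>auto simp: mat_delete_def\<close>)
  ultimately show ?thesis
    using A by (simp only:) (simp add: mat_delete_def numeral_2_eq_2)
qed

lemma totally_unimodular_entry:
  assumes "totally_unimodular U" "r < dim_row U" "i < dim_col U"
  shows "U $$ (r, i) \<in> {-1, 0, 1}"
  using totally_unimodular_det_minor[OF assms(1), of "[r]" 1 "[i]"] assms(2,3)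
    det_single[of "mat 1 1 (\<lambda>(a, b). U $$ ([r] ! a, [i] ! b))"]
  by auto

text \<open>If the two products differed, the four entries, all \<open>\<plusminus>1\<close>, would form a minor \<open>\<plusminus>2\<close>.\<close>
lemma totally_unimodular_common_support_sign:
  assumes tu: "totally_unimodular U"
    and rows: "q < dim_row U" "r < dim_row U"
    and cols: "i < dim_col U" "j < dim_col U" "i \<noteq> j"
    and nz: "U $$ (q, i) * U $$ (q, j) \<noteq> 0" "U $$ (r, i) * U $$ (r, j) \<noteq> 0"
  shows "U $$ (q, i) * U $$ (q, j) = U $$ (r, i) * U $$ (r, j)"
proof (cases "q = r")
  case False
  then have "U $$ (q, i) * U $$ (r, j) - U $$ (q, j) * U $$ (r, i) \<in> {-1, 0, 1}"
    using totally_unimodular_det_minor[OF tu, of "[q, r]" 2 "[i, j]"] rows cols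
    by (simp add: det_2_2)
  moreover have "U $$ (q, i) \<in> {-1, 1}" "U $$ (q, j) \<in> {-1, 1}"
    "U $$ (r, i) \<in> {-1, 1}" "U $$ (r, j) \<in> {-1, 1}"
    using totally_unimodular_entry[OF tu] rows cols nz by fastforce+
  ultimately show ?thesis by auto
qed simp

text \<open>
  The rows \<open>p, q, r\<close> form the incidence matrix of a signed triangle on \<open>h, i, j\<close>. Its determinant
  has just two nonzero terms, each \<open>\<plusminus>1\<close>. They must cancel, and the product of all six entries is
  the product of these two terms.
\<close>
lemma totally_unimodular_no_odd_cycle:
  assumes tu: "totally_unimodular U"
    and rows: "p < dim_row U" "q < dim_row U" "r < dim_row U"
    and cols: "h < dim_col U" "i < dim_col U" "j < dim_col U" "h \<noteq> i" "i \<noteq> j" "h \<noteq> j"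
    and p: "U $$ (p, h) \<noteq> 0" "U $$ (p, i) \<noteq> 0" "U $$ (p, j) = 0"
    and q: "U $$ (q, h) = 0" "U $$ (q, i) \<noteq> 0" "U $$ (q, j) \<noteq> 0"
    and r: "U $$ (r, h) \<noteq> 0" "U $$ (r, i) = 0" "U $$ (r, j) \<noteq> 0"
  shows "(U $$ (p, h) * U $$ (p, i)) * (U $$ (q, i) * U $$ (q, j)) * (U $$ (r, j) * U $$ (r, h)) < 0"
proof -
  let ?x = "U $$ (p, h) * U $$ (q, i) * U $$ (r, j)"
  let ?y = "U $$ (p, i) * U $$ (q, j) * U $$ (r, h)"
  have "distinct [p, q, r]" using p q r by auto
  then have sum: "?x + ?y \<in> {-1, 0, 1}"
    using totally_unimodular_det_minor[OF tu, of "[p, q, r]" 3 "[h, i, j]"] rows cols p q r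
    by (simp add: det_3_3 numeral_2_eq_2 algebra_simps)
  have unit: "\<bar>U $$ (p, h)\<bar> = 1" "\<bar>U $$ (p, i)\<bar> = 1" "\<bar>U $$ (q, i)\<bar> = 1"
    "\<bar>U $$ (q, j)\<bar> = 1" "\<bar>U $$ (r, j)\<bar> = 1" "\<bar>U $$ (r, h)\<bar> = 1"
    using totally_unimodular_entry[OF tu] rows cols p q r by fastforce+
  have "x * y < 0" if "x + y \<in> {-1, 0, 1}" "\<bar>x\<bar> = 1" "\<bar>y\<bar> = 1" for x y :: int
    using that by (auto simp: abs_if split: if_splits)
  moreover have "\<bar>?x\<bar> = 1" "\<bar>?y\<bar> = 1" by (simp_all add: abs_mult unit)
  ultimately have "?x * ?y < 0" using sum by blast
  then show ?thesis by (simp add: mult_ac)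
qed

section \<open>Entries of the Gram matrix as row counts\<close>

definition row_support :: "'a::zero mat \<Rightarrow> nat \<Rightarrow> nat set" where
  "row_support U r = {j. j < dim_col U \<and> U $$ (r, j) \<noteq> 0}"

definition covering_rows :: "'a::zero mat \<Rightarrow> nat set \<Rightarrow> nat set" where
  "covering_rows U S = {r. r < dim_row U \<and> S \<subseteq> row_support U r}"

lemma finite_covering_rows [simp]: "finite (covering_rows U S)"
  by (simp add: covering_rows_def)

lemma gram_entry:
  fixes U :: "int mat"
  assumes "i < dim_col U" "j < dim_col U"
  shows "(transpose_mat U * U) $$ (i, j) = (\<Sum>r<dim_row U. U $$ (r, i) * U $$ (r, j))"
  using assms by (simp add: scalar_prod_def atLeast0LessThan)

text \<open>
  All nonzero summands of the scalar product of columns \<open>i\<close> and \<open>j\<close> are equal, so any one of them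
  determines the sum. The case \<open>i = j\<close> is included.
\<close>
lemma gram_entry_eq_card:
  assumes tu: "totally_unimodular U" and cols: "i < dim_col U" "j < dim_col U"
    and r: "r \<in> covering_rows U {i, j}"
  shows "(transpose_mat U * U) $$ (i, j)
      = U $$ (r, i) * U $$ (r, j) * int (card (covering_rows U {i, j}))"
proof -
  have same: "U $$ (q, i) * U $$ (q, j) = U $$ (r, i) * U $$ (r, j)"
    if "q \<in> covering_rows U {i, j}" for q
  proof (cases "i = j")
    case True
    have "U $$ (q, i) \<in> {-1, 1}" "U $$ (r, i) \<in> {-1, 1}"
      using totally_unimodular_entry[OF tu] that r cols
      by (fastforce simp: covering_rows_def row_support_def)+
    then show ?thesis using True by auto
  next
    case False
    then show ?thesis
      using totally_unimodular_common_support_sign[OF tu _ _ cols False] that r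
      by (auto simp: covering_rows_def row_support_def)
  qed
  have "(transpose_mat U * U) $$ (i, j) = (\<Sum>q<dim_row U. U $$ (q, i) * U $$ (q, j))"
    using cols by (rule gram_entry)
  also have "\<dots> = (\<Sum>q\<in>covering_rows U {i, j}. U $$ (q, i) * U $$ (q, j))"
    using cols by (intro sum.mono_neutral_right) (auto simp: covering_rows_def row_support_def)
  also have "\<dots> = (\<Sum>q\<in>covering_rows U {i, j}. U $$ (r, i) * U $$ (r, j))"
    using same by (intro sum.cong) auto
  finally show ?thesis by simp
qed

lemma abs_gram_entry:
  assumes tu: "totally_unimodular U" and cols: "i < dim_col U" "j < dim_col U"
  shows "\<bar>(transpose_mat U * U) $$ (i, j)\<bar> = int (card (covering_rows U {i, j}))"
proof (cases "covering_rows U {i, j} = {}")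
  case True
  then have "(\<Sum>r<dim_row U. U $$ (r, i) * U $$ (r, j)) = 0"
    using cols by (intro sum.neutral) (auto simp: covering_rows_def row_support_def)
  then show ?thesis using True gram_entry[OF cols] by simp
next
  case False
  then obtain r where r: "r \<in> covering_rows U {i, j}" by blast
  have "U $$ (r, i) \<in> {-1, 1}" "U $$ (r, j) \<in> {-1, 1}"
    using totally_unimodular_entry[OF tu] r cols
    by (fastforce simp: covering_rows_def row_support_def)+
  then have "\<bar>U $$ (r, i) * U $$ (r, j)\<bar> = 1" by auto
  then show ?thesis using gram_entry_eq_card[OF tu cols r] by (simp add: abs_mult)
qed

text \<open>
  The form in which the previous identity enters sign computations: the sign of a Gram matrix
  entry is seen in every row covering both columns.
\<close>
lemma gram_entry_positive_multiple:
  assumes tu: "totally_unimodular U" and cols: "i < dim_col U" "j < dim_col U"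
    and r: "r \<in> covering_rows U {i, j}"
  obtains c where "c > 0" "(transpose_mat U * U) $$ (i, j) = U $$ (r, i) * U $$ (r, j) * c"
proof
  show "int (card (covering_rows U {i, j})) > 0"
    using r by (auto simp: card_gt_0_iff)
qed (rule gram_entry_eq_card[OF tu cols r])

section \<open>The function \<open>f\<close> counts covering rows\<close>

text \<open>
  A row covering \<open>h, i, j\<close> shows the signs of all three Gram matrix entries at once, and every entry
  of the row occurs twice in their product.
\<close>
lemma covering_rows_negative_triple:
  assumes tu: "totally_unimodular U"
    and Y: "Y \<in> negative_triples (transpose_mat U * U)" "Y \<subseteq> S"
  shows "covering_rows U S = {}"
proof (rule ccontr)
  let ?A = "transpose_mat U * U"
  obtain h i j where hij: "Y = {h, i, j}" "h < dim_col U" "i < dim_col U" "j < dim_col U"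
    and neg: "?A $$ (h, i) * ?A $$ (i, j) * ?A $$ (j, h) < 0"
    using Y by (auto simp: negative_triples_def)
  assume "covering_rows U S \<noteq> {}"
  then obtain r where "r \<in> covering_rows U S" by blast
  then have r: "r \<in> covering_rows U {h, i}" "r \<in> covering_rows U {i, j}" "r \<in> covering_rows U {j, h}"
    using Y hij by (auto simp: covering_rows_def)
  obtain c where c: "c > 0" "?A $$ (h, i) = U $$ (r, h) * U $$ (r, i) * c"
    using gram_entry_positive_multiple[OF tu hij(2,3) r(1)] .
  obtain d where d: "d > 0" "?A $$ (i, j) = U $$ (r, i) * U $$ (r, j) * d"
    using gram_entry_positive_multiple[OF tu hij(3,4) r(2)] .
  obtain e where e: "e > 0" "?A $$ (j, h) = U $$ (r, j) * U $$ (r, h) * e"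
    using gram_entry_positive_multiple[OF tu hij(4,2) r(3)] .
  have "?A $$ (h, i) * ?A $$ (i, j) * ?A $$ (j, h)
      = (U $$ (r, h) * U $$ (r, i) * U $$ (r, j))\<^sup>2 * (c * d * e)"
    unfolding c d e by (simp add: power2_eq_square algebra_simps)
  also have "\<dots> \<ge> 0" using c d e by simp
  finally show False using neg by simp
qed

text \<open>
  Rows witnessing the failure of all three inclusions would form a signed triangle, whose entries
  force the product of the three Gram matrix entries to be negative.
\<close>
lemma covering_rows_triple_nested:
  assumes tu: "totally_unimodular U"
    and cols: "h < dim_col U" "i < dim_col U" "j < dim_col U" "h \<noteq> i" "i \<noteq> j" "h \<noteq> j"
    and not_neg: "{h, i, j} \<notin> negative_triples (transpose_mat U * U)"
  shows "covering_rows U {h, i} \<subseteq> covering_rows U {j}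
       \<or> covering_rows U {i, j} \<subseteq> covering_rows U {h}
       \<or> covering_rows U {j, h} \<subseteq> covering_rows U {i}"
proof (rule ccontr)
  let ?A = "transpose_mat U * U"
  assume "\<not> ?thesis"
  then obtain p q r where
    p: "p \<in> covering_rows U {h, i}" "p \<notin> covering_rows U {j}" and
    q: "q \<in> covering_rows U {i, j}" "q \<notin> covering_rows U {h}" and
    r: "r \<in> covering_rows U {j, h}" "r \<notin> covering_rows U {i}"
    by blast
  have neg: "(U $$ (p, h) * U $$ (p, i)) * (U $$ (q, i) * U $$ (q, j)) * (U $$ (r, j) * U $$ (r, h)) < 0"
    by (rule totally_unimodular_no_odd_cycle[OF tu])
      (use p q r cols in \<open>auto simp: covering_rows_def row_support_def\<close>)
  obtain c where c: "c > 0" "?A $$ (h, i) = U $$ (p, h) * U $$ (p, i) * c"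
    using gram_entry_positive_multiple[OF tu cols(1,2) p(1)] .
  obtain d where d: "d > 0" "?A $$ (i, j) = U $$ (q, i) * U $$ (q, j) * d"
    using gram_entry_positive_multiple[OF tu cols(2,3) q(1)] .
  obtain e where e: "e > 0" "?A $$ (j, h) = U $$ (r, j) * U $$ (r, h) * e"
    using gram_entry_positive_multiple[OF tu cols(3,1) r(1)] .
  have "?A $$ (h, i) * ?A $$ (i, j) * ?A $$ (j, h)
      = ((U $$ (p, h) * U $$ (p, i)) * (U $$ (q, i) * U $$ (q, j)) * (U $$ (r, j) * U $$ (r, h)))
        * (c * d * e)"
    unfolding c d e by (simp add: algebra_simps)
  also have "\<dots> < 0" using c d e by (intro mult_neg_pos[OF neg]) simp
  finally have "{h, i, j} \<in> negative_triples ?A"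
    unfolding negative_triples_def using cols by (simp del: index_mult_mat(1)) blast
  with not_neg show False ..
qed

text \<open>
  The triple property suffices for sets of any size because the rows covering both members of a
  pair, if the pair is chosen with as few such rows as possible, cover all of \<open>S\<close>.
\<close>
lemma f_fun_gram_eq_card:
  assumes tu: "totally_unimodular U" and S: "S \<noteq> {}" "S \<subseteq> {..<dim_col U}"
  shows "f_fun (transpose_mat U * U) S = int (card (covering_rows U S))"
proof -
  let ?A = "transpose_mat U * U"
  have fin: "finite S" using S finite_subset by blast
  consider (neg) "\<exists>Y\<in>negative_triples ?A. Y \<subseteq> S"
    | (single) i where "S = {i}" "\<not> (\<exists>Y\<in>negative_triples ?A. Y \<subseteq> S)"
    | (many) "card S \<noteq> 1" "\<not> (\<exists>Y\<in>negative_triples ?A. Y \<subseteq> S)"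
    by (metis card_1_singletonE)
  then show ?thesis
  proof cases
    case neg
    then show ?thesis using covering_rows_negative_triple[OF tu] by (auto simp: f_fun_def)
  next
    case single
    then have i: "i < dim_col U" using S by auto
    then have "?A $$ (i, i) \<ge> 0" using gram_entry[OF i i] by (simp add: sum_nonneg)
    then show ?thesis using abs_gram_entry[OF tu i i] single by (simp add: f_fun_def)
  next
    case many
    let ?c = "\<lambda>i j. card (covering_rows U {i, j})"
    have mono: "covering_rows U S \<subseteq> covering_rows U {i, j}" if "i \<in> S" "j \<in> S" for i j
      using that by (auto simp: covering_rows_def)
    define P where "P = {(i, j). i \<in> S \<and> j \<in> S \<and> i \<noteq> j}"
    have "P \<subseteq> S \<times> S" by (auto simp: P_def)
    then have "finite P" using fin finite_subset by blast
    have "P \<noteq> {}"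
    proof
      assume "P = {}"
      moreover obtain i where "i \<in> S" using S by blast
      ultimately have "S = {i}" by (auto simp: P_def)
      with many show False by simp
    qed
    then obtain z where z: "z \<in> P" and z_min: "\<And>y. y \<in> P \<Longrightarrow> case_prod ?c z \<le> case_prod ?c y"
      using arg_min_if_finite[OF \<open>finite P\<close>, of "case_prod ?c"] by (metis not_le)
    obtain i j where zij: "z = (i, j)" by fastforce
    with z have ij: "i \<in> S" "j \<in> S" "i \<noteq> j" by (auto simp: P_def)
    have min: "?c i j \<le> ?c h k" if "h \<in> S" "k \<in> S" "h \<noteq> k" for h k
      using z_min[of "(h, k)"] that zij by (auto simp: P_def)
    have not_smaller: "\<not> covering_rows U {h, k} \<subset> covering_rows U {i, j}"
      if "h \<in> S" "k \<in> S" "h \<noteq> k" for h k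
      using min[OF that] by (meson finite_covering_rows leD psubset_card_mono)
    have meet: "covering_rows U {a, b} = covering_rows U {a} \<inter> covering_rows U {b}" for a b
      by (auto simp: covering_rows_def)
    have "covering_rows U {i, j} \<subseteq> covering_rows U {k}" if k: "k \<in> S" for k
    proof (cases "k = i \<or> k = j")
      case True
      then show ?thesis using meet by auto
    next
      case False
      \<comment> \<open>The second and third inclusion would put \<open>R\<^sub>j \<inter> R\<^sub>k\<close> or \<open>R\<^sub>k \<inter> R\<^sub>i\<close> inside \<open>R\<^sub>i \<inter> R\<^sub>j\<close>; by
        minimality equality holds, and then the first inclusion holds as well.\<close>
      have "{i, j, k} \<subseteq> S" using ij k by simp
      then have "{i, j, k} \<notin> negative_triples ?A" using many(2) by blast
      then have "covering_rows U {i, j} \<subseteq> covering_rows U {k}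
          \<or> covering_rows U {j, k} \<subseteq> covering_rows U {i}
          \<or> covering_rows U {k, i} \<subseteq> covering_rows U {j}"
        using covering_rows_triple_nested[OF tu, of i j k] False ij k S by auto
      then show ?thesis
        using not_smaller[of j k] not_smaller[of k i] False ij k meet by blast
    qed
    then have "covering_rows U {i, j} \<subseteq> covering_rows U S"
      using S by (auto simp: covering_rows_def)
    then have eq: "covering_rows U S = covering_rows U {i, j}" using mono ij by blast
    have in_range: "h < dim_col U" if "h \<in> S" for h using that S by auto
    have "Min {\<bar>?A $$ (h, k)\<bar> | h k. h \<in> S \<and> k \<in> S \<and> h \<noteq> k} = int (?c i j)"
    proof (rule Min_eqI)
      have "{\<bar>?A $$ (h, k)\<bar> | h k. h \<in> S \<and> k \<in> S \<and> h \<noteq> k} = (\<lambda>(h, k). \<bar>?A $$ (h, k)\<bar>) ` P"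
        by (auto simp: P_def)
      then show "finite {\<bar>?A $$ (h, k)\<bar> | h k. h \<in> S \<and> k \<in> S \<and> h \<noteq> k}"
        using \<open>finite P\<close> by simp
      show "int (?c i j) \<in> {\<bar>?A $$ (h, k)\<bar> | h k. h \<in> S \<and> k \<in> S \<and> h \<noteq> k}"
        using abs_gram_entry[OF tu in_range[OF ij(1)] in_range[OF ij(2)], symmetric] ij by blast
      fix y assume "y \<in> {\<bar>?A $$ (h, k)\<bar> | h k. h \<in> S \<and> k \<in> S \<and> h \<noteq> k}"
      then obtain h k where y: "y = \<bar>?A $$ (h, k)\<bar>" and hk: "h \<in> S" "k \<in> S" "h \<noteq> k" by blast
      then show "int (?c i j) \<le> y"
        unfolding y abs_gram_entry[OF tu in_range[OF hk(1)] in_range[OF hk(2)]]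
        using min[OF hk] by linarith
    qed
    then show ?thesis unfolding f_fun_def eq using S many by (simp only: if_False)
  qed
qed

section \<open>Moebius inversion\<close>

lemma sum_alternating_interval:
  assumes fin: "finite T" and sub: "S \<subseteq> T"
  shows "(\<Sum>S'\<in>{S'. S \<subseteq> S' \<and> S' \<subseteq> T}. (-1 :: int) ^ card (S' - S)) = of_bool (S = T)"
proof -
  have "(\<Sum>S'\<in>{S'. S \<subseteq> S' \<and> S' \<subseteq> T}. (-1 :: int) ^ card (S' - S))
      = (\<Sum>W\<in>Pow (T - S). (-1) ^ card W)"
    by (rule sum.reindex_bij_witness[where i = "\<lambda>W. W \<union> S" and j = "\<lambda>S'. S' - S"])
      (use sub in auto)
  also have "\<dots> = of_bool (S = T)"
  proof (cases "S = T")
    case False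
    then have "card {W. W \<subseteq> T - S \<and> even (card W)} = card {W. W \<subseteq> T - S \<and> odd (card W)}"
      using card_subsupersets_even_odd[of "T - S" "{}"] fin sub by auto
    then show ?thesis
      using False fin by (simp add: sum_alternating_cancels)
  qed simp
  finally show ?thesis .
qed

text \<open>
  After exchanging the two summations, a row with support \<open>T\<close> contributes the alternating sum over
  the interval between \<open>S\<close> and \<open>T\<close>, which vanishes unless \<open>S = T\<close>. The case \<open>S = {}\<close> is
  different, because \<open>f\<close> is 0 at the empty set while every row covers it.
\<close>
lemma g_fun_gram_eq_card:
  assumes tu: "totally_unimodular U" and S: "S \<noteq> {}" "S \<subseteq> {..<dim_col U}"
  shows "g_fun (transpose_mat U * U) S = int (card {r. r < dim_row U \<and> row_support U r = S})"
proof -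
  let ?I = "{S'. S \<subseteq> S' \<and> S' \<subseteq> {..<dim_col U}}"
  have "g_fun (transpose_mat U * U) S
      = (\<Sum>S'\<in>?I. (-1) ^ card (S' - S) * (\<Sum>r<dim_row U. of_bool (S' \<subseteq> row_support U r)))"
    unfolding g_fun_def
  proof (rule sum.cong)
    fix S' assume "S' \<in> ?I"
    then have "f_fun (transpose_mat U * U) S' = int (card (covering_rows U S'))"
      using S by (intro f_fun_gram_eq_card[OF tu]) auto
    also have "covering_rows U S' = {..<dim_row U} \<inter> {r. S' \<subseteq> row_support U r}"
      by (auto simp: covering_rows_def)
    finally show "(-1) ^ card (S' - S) * f_fun (transpose_mat U * U) S'
        = (-1) ^ card (S' - S) * (\<Sum>r<dim_row U. of_bool (S' \<subseteq> row_support U r))"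
      by (simp add: of_bool_def sum.If_cases)
  qed simp
  also have "\<dots> = (\<Sum>r<dim_row U. \<Sum>S'\<in>?I. (-1) ^ card (S' - S) * of_bool (S' \<subseteq> row_support U r))"
    unfolding sum_distrib_left by (rule sum.swap)
  also have "\<dots> = (\<Sum>r<dim_row U. of_bool (row_support U r = S))"
  proof (rule sum.cong)
    fix r
    let ?T = "row_support U r"
    have fin: "finite ?T" and "?T \<subseteq> {..<dim_col U}" by (auto simp: row_support_def)
    then have "(\<Sum>S'\<in>?I. (-1) ^ card (S' - S) * of_bool (S' \<subseteq> ?T))
        = (\<Sum>S'\<in>{S'. S \<subseteq> S' \<and> S' \<subseteq> ?T}. (-1 :: int) ^ card (S' - S))"
      by (intro sum.mono_neutral_cong_right) auto
    also have "\<dots> = of_bool (?T = S)"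
    proof (cases "S \<subseteq> ?T")
      case True
      then show ?thesis using sum_alternating_interval[OF fin] by auto
    next
      case False
      then have empty: "{S'. S \<subseteq> S' \<and> S' \<subseteq> ?T} = {}" and "?T \<noteq> S" by auto
      then show ?thesis unfolding empty by simp
    qed
    finally show "(\<Sum>S'\<in>?I. (-1) ^ card (S' - S) * of_bool (S' \<subseteq> ?T)) = (of_bool (?T = S) :: int)" .
  qed simp
  also have "\<dots> = int (card ({..<dim_row U} \<inter> {r. row_support U r = S}))"
    by (simp add: of_bool_def sum.If_cases)
  also have "{..<dim_row U} \<inter> {r. row_support U r = S} = {r. r < dim_row U \<and> row_support U r = S}"
    by auto
  finally show ?thesis .
qed

text \<open>
  The values of \<open>g\<close> sum to 0, so \<open>- g {}\<close> is the number of rows with any nonempty support.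
\<close>
lemma minus_g_fun_empty_gram:
  assumes tu: "totally_unimodular U"
  shows "- g_fun (transpose_mat U * U) {} = int (card {r. r < dim_row U \<and> row_support U r \<noteq> {}})"
proof -
  let ?g = "g_fun (transpose_mat U * U)" and ?P = "Pow {..<dim_col U} - {{}}"
  have "- ?g {} = (\<Sum>S\<in>?P. ?g S)"
    using sum_g_fun[of "transpose_mat U * U"] sum.remove[of "Pow {..<dim_col U}" "{}" ?g] by simp
  also have "\<dots> = int (\<Sum>S\<in>?P. card {r. r < dim_row U \<and> row_support U r = S})"
    using g_fun_gram_eq_card[OF tu] by simp
  also have "(\<Sum>S\<in>?P. card {r. r < dim_row U \<and> row_support U r = S})
      = card (\<Union>S\<in>?P. {r. r < dim_row U \<and> row_support U r = S})"
    by (rule card_UN_disjoint[symmetric]) auto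
  also have "(\<Union>S\<in>?P. {r. r < dim_row U \<and> row_support U r = S})
      = {r. r < dim_row U \<and> row_support U r \<noteq> {}}"
    by (auto simp: row_support_def)
  finally show ?thesis .
qed

lemma g_nonnegative_gram:
  assumes tu: "totally_unimodular U" and "no_zero_cols U"
  shows "g_nonnegative (transpose_mat U * U)"
proof -
  let ?A = "transpose_mat U * U"
  have "?A $$ (i, i) > 0" if i: "i < dim_col U" for i
  proof -
    have "\<exists>r<dim_row U. U $$ (r, i) \<noteq> 0"
    proof (rule ccontr)
      assume "\<not> ?thesis"
      then have "col U i = 0\<^sub>v (dim_row U)" using i by (intro eq_vecI) auto
      then show False using assms i by (simp add: no_zero_cols_def)
    qed
    then obtain r where "r < dim_row U" "U $$ (r, i) \<noteq> 0" by blast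
    then have "(\<Sum>r<dim_row U. U $$ (r, i) * U $$ (r, i)) > 0"
      by (intro sum_pos2[of _ r]) (auto simp: zero_less_mult_iff)
    then show ?thesis using gram_entry[OF i i] by simp
  qed
  moreover have "transpose_mat ?A = ?A"
    by (subst transpose_mult[of _ "dim_col U" "dim_row U" _ "dim_col U"]) auto
  ultimately show ?thesis
    using g_fun_gram_eq_card[OF tu] by (auto simp: g_nonnegative_def symmetric_posdiag_def)
qed

section \<open>Comparison of the rows\<close>

lemma row_abs_mat_eq_indicator:
  assumes tu: "totally_unimodular U" and r: "r < dim_row U"
  shows "row (abs_mat U) r = indicator_vec (dim_col U) (row_support U r)"
proof (rule eq_vecI)
  fix j assume "j < dim_vec (indicator_vec (dim_col U) (row_support U r))"
  then have j: "j < dim_col U" by (simp add: indicator_vec_def)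
  show "row (abs_mat U) r $ j = indicator_vec (dim_col U) (row_support U r) $ j"
    using totally_unimodular_entry[OF tu r j] r j
    by (auto simp: abs_mat_def indicator_vec_def row_support_def)
qed (simp add: abs_mat_def indicator_vec_def)

lemma indicator_vec_inject:
  assumes "S \<subseteq> {..<s}" "T \<subseteq> {..<s}"
  shows "indicator_vec s S = indicator_vec s T \<longleftrightarrow> S = T"
proof
  assume eq: "indicator_vec s S = indicator_vec s T"
  have "j \<in> S \<longleftrightarrow> j \<in> T" if "j < s" for j
    using arg_cong[OF eq, of "\<lambda>v. v $ j"] that by (auto simp: indicator_vec_def split: if_splits)
  then show "S = T" using assms by blast
qed simp

lemma count_rows:
  "count (mset (rows M)) v = card {i. i < dim_row M \<and> row M i = v}"
proof -
  have "count (mset vs) v = length (filter (\<lambda>u. u = v) vs)" for vs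
    by (induction vs) auto
  then have "count (mset (rows M)) v = length (filter (\<lambda>u. u = v) (rows M))" .
  also have "\<dots> = card {i. i < dim_row M \<and> row M i = v}"
    unfolding length_filter_conv_card by (intro arg_cong[where f = card]) auto
  finally show ?thesis .
qed

lemma permute_rows_of_mset_eq:
  assumes dim: "dim_col X = n" and eq: "mset ds = mset (rows X)"
  shows "\<exists>p. p permutes {..<dim_row X} \<and> permute_rows p X = mat_of_rows n ds"
proof -
  obtain p where p: "p permutes {..<length (rows X)}" "permute_list p (rows X) = ds"
    using mset_eq_permutation[OF eq] .
  have len: "length ds = dim_row X" using arg_cong[OF eq, of size] by simp
  have "permute_rows p X = mat_of_rows n ds"
  proof (rule eq_matI)
    fix i j assume "i < dim_row (mat_of_rows n ds)" "j < dim_col (mat_of_rows n ds)"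
    then have i: "i < dim_row X" and j: "j < n" using len by auto
    have "p i < dim_row X" using permutes_in_image[OF p(1), of i] i by simp
    moreover have "ds ! i = rows X ! p i"
      using permute_list_nth[OF p(1), of i] i p(2) by simp
    ultimately show "permute_rows p X $$ (i, j) = mat_of_rows n ds $$ (i, j)"
      using i j len dim by (simp add: permute_rows_def mat_of_rows_def)
  qed (use len dim in \<open>auto simp: permute_rows_def\<close>)
  then show ?thesis using p by auto
qed

text \<open>
  Every nonzero row of \<open>U\<^sup>\<sharp>\<close> is the indicator of its nonempty support and occurs equally often in
  \<open>X\<close>. This gives an inclusion of multisets; it is an equality because both have \<open>- g {}\<close> elements.
  In particular \<open>X\<close> has no zero row.
\<close>
lemma mset_rows_of_is_X_gram:
  assumes tu: "totally_unimodular U" and X: "is_X (transpose_mat U * U) X"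
  shows "mset (filter (\<lambda>v. v \<noteq> 0\<^sub>v (dim_col U)) (rows (abs_mat U))) = mset (rows X)"
proof -
  let ?s = "dim_col U" and ?D = "filter_mset (\<lambda>v. v \<noteq> 0\<^sub>v (dim_col U)) (mset (rows (abs_mat U)))"
  have dim: "dim_row (abs_mat U) = dim_row U" by (simp add: abs_mat_def)
  have supp: "row_support U r \<subseteq> {..<?s}" for r by (auto simp: row_support_def)
  have row_eq: "row (abs_mat U) r = indicator_vec ?s S \<longleftrightarrow> row_support U r = S"
    if "r < dim_row U" "S \<subseteq> {..<?s}" for r S
    using row_abs_mat_eq_indicator[OF tu that(1)] indicator_vec_inject[OF supp that(2)] by simp
  have zero: "0\<^sub>v ?s = indicator_vec ?s {}" by (auto simp: indicator_vec_def)
  have "?D \<subseteq># mset (rows X)"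
  proof (rule mset_subset_eqI)
    fix v
    show "count ?D v \<le> count (mset (rows X)) v"
    proof (cases "v \<in># ?D")
      case True
      then obtain r where r: "r < dim_row U" "v = row (abs_mat U) r" "v \<noteq> 0\<^sub>v ?s"
        by (auto simp: rows_def dim)
      define S where "S = row_support U r"
      have v: "v = indicator_vec ?s S" using row_abs_mat_eq_indicator[OF tu r(1)] r by (simp add: S_def)
      have S: "S \<noteq> {}" "S \<subseteq> {..<?s}" using r(3) v zero supp by (auto simp: S_def)
      have "{i. i < dim_row U \<and> row (abs_mat U) i = v} = {i. i < dim_row U \<and> row_support U i = S}"
        using row_eq S v by auto
      then have "count ?D v = card {i. i < dim_row U \<and> row_support U i = S}"
        using r(3) by (simp add: count_rows dim)
      also have "int \<dots> = int (card {i. i < dim_row X \<and> row X i = v})"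
        using X S unfolding is_X_def v g_fun_gram_eq_card[OF tu S, symmetric] by simp
      finally show ?thesis by (simp add: count_rows)
    next
      case False
      then have "count ?D v = 0" by (simp only: not_in_iff)
      then show ?thesis by linarith
    qed
  qed
  moreover have "size ?D = size (mset (rows X))"
  proof -
    have "size ?D = length (filter (\<lambda>v. v \<noteq> 0\<^sub>v ?s) (rows (abs_mat U)))"
      by (metis mset_filter size_mset)
    also have "\<dots> = card {r. r < dim_row U \<and> row_support U r \<noteq> {}}"
      unfolding length_filter_conv_card using row_eq zero
      by (intro arg_cong[where f = card]) (auto simp: dim)
    also have "\<dots> = dim_row X"
      using X minus_g_fun_empty_gram[OF tu] by (simp add: is_X_def)
    finally show ?thesis by simp
  qed
  ultimately show ?thesis by (metis mset_filter mset_subset_size subset_mset.less_le less_irrefl)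
qed

theorem corollary15:
  fixes U A :: "int mat"
  assumes "totally_unimodular U"
    and "no_zero_cols U"
    and "A = transpose_mat U * U"
  shows "g_nonnegative A \<and>
    (\<forall>X. is_X A X \<longrightarrow>
       (\<exists>p. p permutes {..<dim_row X} \<and> permute_rows p X = delete_zero_rows (abs_mat U)))"
proof (intro conjI allI impI)
  show "g_nonnegative A" using g_nonnegative_gram assms by simp
  fix X assume X: "is_X A X"
  let ?ds = "filter (\<lambda>v. v \<noteq> 0\<^sub>v (dim_col U)) (rows (abs_mat U))"
  have dim: "dim_col (abs_mat U) = dim_col U" by (simp add: abs_mat_def)
  have "\<exists>p. p permutes {..<dim_row X} \<and> permute_rows p X = mat_of_rows (dim_col U) ?ds"
  proof (rule permute_rows_of_mset_eq)
    show "dim_col X = dim_col U" using X assms by (simp add: is_X_def)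
    show "mset ?ds = mset (rows X)" using mset_rows_of_is_X_gram assms X by simp
  qed
  then show "\<exists>p. p permutes {..<dim_row X} \<and> permute_rows p X = delete_zero_rows (abs_mat U)"
    by (simp add: delete_zero_rows_def dim)
qed

end
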